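(* Let $X$ be a Banach space with an unconditional basis $\{e_n\}_{n\in\mathbb N}$, and let $X^+$ be the positive cone of $X$ associated with $\{e_n\}$, i.e. $$X^+=\Big\{x=\sum_n a_ne_n\in X:\ a_n\ge0\text{ for all }n\in\mathbb N\Big\}.$$ Then: (i) $(X^+)_N=\{x=\sum_n a_ne_n\in X:\ a_n>0\text{ for all }n\in\mathbb N\}$; (ii) for all $u\in(X^+)_N$, $(X_u,\|\cdot\|_u)$ is isometrically isomorphic to $\ell_\infty$.
   Context: Real scalars. For a closed convex set $C\subset X$, $C_N$ denotes the set of points $x\in C$ that are not support points, where $x\in C$ is a support point if there is a nonzero $x^*\in X^*$ with $\langle x^*,x\rangle=\max\{\langle x^*,y\rangle:y\in C\}$. For the order $x\ge y\iff x-y\in X^+$ and $u\in (X^+)_N$, let $[-u,u]=\{x\in X:-u\le x\le u\}$, $X_u=C_u\cap(-C_u)$ with $C_u=\bigcup_{\lambda>0}\lambda(X^+-u)$ (equivalently $X_u=\bigcup_{\lambda>0}\lambda[-u,u]$), and $\|x\|_u=\inf\{\lambda>0:x\in\lambda[-u,u]\}$ for $x\in X_u$. *)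

theory Defs
  imports "HOL-Analysis.Analysis"
begin

definition schauder_basis :: "(nat \<Rightarrow> 'a::real_normed_vector) \<Rightarrow> bool" where
  "schauder_basis e \<longleftrightarrow> (\<forall>x. \<exists>!a :: nat \<Rightarrow> real. (\<lambda>n. a n *\<^sub>R e n) sums x)"

definition unconditionally_convergent :: "(nat \<Rightarrow> 'a::real_normed_vector) \<Rightarrow> bool" where
  "unconditionally_convergent f \<longleftrightarrow> (\<forall>\<pi>. bij \<pi> \<longrightarrow> summable (f \<circ> \<pi>))"

definition unconditional_basis :: "(nat \<Rightarrow> 'a::real_normed_vector) \<Rightarrow> bool" where
  "unconditional_basis e \<longleftrightarrow> schauder_basis e \<and>
     (\<forall>a :: nat \<Rightarrow> real. summable (\<lambda>n. a n *\<^sub>R e n) \<longrightarrow>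
        unconditionally_convergent (\<lambda>n. a n *\<^sub>R e n))"

definition positive_cone :: "(nat \<Rightarrow> 'a::real_normed_vector) \<Rightarrow> 'a set" where
  "positive_cone e = {x. \<exists>a :: nat \<Rightarrow> real. (\<forall>n. a n \<ge> 0) \<and> (\<lambda>n. a n *\<^sub>R e n) sums x}"

definition support_point :: "'a::real_normed_vector set \<Rightarrow> 'a \<Rightarrow> bool" where
  "support_point C x \<longleftrightarrow> x \<in> C \<and>
     (\<exists>f :: 'a \<Rightarrow>\<^sub>L real. f \<noteq> 0 \<and> (\<forall>y\<in>C. blinfun_apply f y \<le> blinfun_apply f x))"

definition nonsupport_points :: "'a::real_normed_vector set \<Rightarrow> 'a set" where
  "nonsupport_points C = {x \<in> C. \<not> support_point C x}"

text \<open>Every function on the discrete space \<open>nat\<close> is continuous, so this is the space of bounded real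
  sequences with the supremum norm.\<close>

type_synonym linfty = "nat \<Rightarrow>\<^sub>C real"

text \<open>In the following, \<open>K\<close> is the cone \<open>X\<^sup>+\<close> inducing the order.\<close>

definition cone_le :: "'a::real_vector set \<Rightarrow> 'a \<Rightarrow> 'a \<Rightarrow> bool" where
  "cone_le K x y \<longleftrightarrow> y - x \<in> K"

definition order_interval :: "'a::real_vector set \<Rightarrow> 'a \<Rightarrow> 'a set" where
  "order_interval K u = {x. cone_le K (- u) x \<and> cone_le K x u}"

definition cone_at :: "'a::real_vector set \<Rightarrow> 'a \<Rightarrow> 'a set" where
  "cone_at K u = (\<Union>t\<in>{0<..}. (\<lambda>y. t *\<^sub>R (y - u)) ` K)"

definition unit_space :: "'a::real_vector set \<Rightarrow> 'a \<Rightarrow> 'a set" where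
  "unit_space K u = cone_at K u \<inter> uminus ` cone_at K u"

definition unit_norm :: "'a::real_vector set \<Rightarrow> 'a \<Rightarrow> 'a \<Rightarrow> real" where
  "unit_norm K u x = Inf {t. t > 0 \<and> x \<in> (*\<^sub>R) t ` order_interval K u}"

end

(* The coordinate functionals of a Schauder basis are continuous (Banach), and X^+ is the set of points
   with nonnegative coordinates. If a point of X^+ has a vanishing coordinate, minus that coordinate
   functional supports X^+ there. Conversely, a functional f supporting the cone X^+ at
   x = sum a_n e_n satisfies f <= 0 on X^+ and f x = 0, so that a_n f(e_n) = 0 for all n and, if all
   a_n are positive, f = 0.
   For u = sum u_n e_n with all u_n > 0, the isometry sends a bounded sequence y to sum y_n u_n e_n,
   which converges because unconditional convergence allows bounded multipliers. *)

theory Submission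
  imports Defs
begin

subsection \<open>Coordinates with respect to a Schauder basis\<close>

text \<open>The whole coefficient sequence is chosen at once, so uniqueness in
  \<open>schauder_basis\<close> applies directly. The value is unspecified where no unique expansion
  exists.\<close>

definition basis_coord :: "(nat \<Rightarrow> 'a::real_normed_vector) \<Rightarrow> 'a \<Rightarrow> nat \<Rightarrow> real" where
  "basis_coord e x = (THE a. (\<lambda>n. a n *\<^sub>R e n) sums x)"

lemma basis_coord_sums:
  assumes "schauder_basis e"
  shows "(\<lambda>n. basis_coord e x n *\<^sub>R e n) sums x"
  using assms theI'[of "\<lambda>a. (\<lambda>n. a n *\<^sub>R e n) sums x"]
  unfolding basis_coord_def schauder_basis_def by blast

lemma basis_coord_eqI:
  assumes "schauder_basis e" "(\<lambda>n. a n *\<^sub>R e n) sums x"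
  shows "basis_coord e x = a"
  using assms basis_coord_sums[OF assms(1), of x] unfolding schauder_basis_def by blast

lemma linear_basis_coord:
  assumes e: "schauder_basis e"
  shows "linear (\<lambda>x. basis_coord e x n)"
proof (rule linearI)
  fix x y and r :: real
  have "(\<lambda>n. (basis_coord e x n + basis_coord e y n) *\<^sub>R e n) sums (x + y)"
    using sums_add[OF basis_coord_sums[OF e, of x] basis_coord_sums[OF e, of y]]
    by (simp add: scaleR_add_left)
  from basis_coord_eqI[OF e this] show "basis_coord e (x + y) n = basis_coord e x n + basis_coord e y n"
    by simp
  have "(\<lambda>n. (r * basis_coord e x n) *\<^sub>R e n) sums (r *\<^sub>R x)"
    using sums_scaleR_right[OF basis_coord_sums[OF e, of x], of r] by simp
  from basis_coord_eqI[OF e this] show "basis_coord e (r *\<^sub>R x) n = r *\<^sub>R basis_coord e x n"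
    by simp
qed

lemma basis_coord_basis:
  assumes e: "schauder_basis e"
  shows "basis_coord e (e m) = (\<lambda>n. if n = m then 1 else 0)"
proof (rule basis_coord_eqI[OF e])
  have "(\<lambda>n. if n = m then e n else 0) sums e m"
    by (rule sums_single)
  then show "(\<lambda>n. (if n = m then 1 else 0) *\<^sub>R e n) sums e m"
    by (simp add: if_distrib[of "\<lambda>c. c *\<^sub>R e _"] cong: if_cong)
qed

text \<open>A vanishing \<open>e n\<close> would give the vector 0 two different coordinate
  sequences. This licenses division by \<open>norm (e n)\<close> in the continuity estimate.\<close>

lemma schauder_basis_nonzero:
  assumes e: "schauder_basis e"
  shows "e n \<noteq> 0"
proof
  assume "e n = 0"
  then have "basis_coord e (e n) = basis_coord e 0" by simp
  moreover have "basis_coord e 0 = (\<lambda>n. 0)" by (rule basis_coord_eqI[OF e]) simp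
  ultimately show False using basis_coord_basis[OF e, of n] by (metis zero_neq_one)
qed

section \<open>Partial sums and Banach's theorem on the continuity of the coordinates\<close>

definition basis_partial_sum :: "(nat \<Rightarrow> 'a::real_normed_vector) \<Rightarrow> nat \<Rightarrow> 'a \<Rightarrow> 'a" where
  "basis_partial_sum e N x = (\<Sum>n<N. basis_coord e x n *\<^sub>R e n)"

lemma linear_basis_partial_sum:
  assumes "schauder_basis e"
  shows "linear (basis_partial_sum e N)"
  unfolding basis_partial_sum_def
  by (intro linear_compose_sum ballI linear_scaleR_left linear_compose[unfolded o_def, OF linear_basis_coord[OF assms]])

lemma basis_partial_sum_tendsto:
  assumes "schauder_basis e"
  shows "(\<lambda>N. basis_partial_sum e N x) \<longlonglongrightarrow> x"
  using basis_coord_sums[OF assms, of x] by (simp add: basis_partial_sum_def sums_def)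

text \<open>The Baire step of the open mapping theorem for the norm \<open>SUP N. norm (basis_partial_sum e N x)\<close>.\<close>

lemma basis_partial_sum_approx:
  fixes e :: "nat \<Rightarrow> 'a::banach"
  assumes e: "schauder_basis e"
  obtains M where "M > 0"
    "\<And>x. \<exists>y. norm (x - y) \<le> norm x / 2 \<and> (\<forall>N. norm (basis_partial_sum e N y) \<le> M * norm x)"
proof -
  note lin = linear_basis_partial_sum[OF e]
  define A where "A k = {x. \<forall>N. norm (basis_partial_sum e N x) \<le> real k}" for k
  have "\<exists>k. x \<in> A k" for x
  proof -
    obtain B where "\<And>N. norm (basis_partial_sum e N x) \<le> B"
      using convergent_imp_Bseq[OF convergentI[OF basis_partial_sum_tendsto[OF e, of x]]]
      by (auto simp: Bseq_def)
    moreover obtain k where "B \<le> real k" using real_arch_simple by blast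
    ultimately show ?thesis unfolding A_def using order_trans by blast
  qed
  moreover have "A k \<subseteq> closure (A k)" for k by (rule closure_subset)
  ultimately have cover: "\<Union>(range (\<lambda>k. closure (A k))) = UNIV" by blast
  obtain k where "interior (closure (A k)) \<noteq> {}"
  proof (rule ccontr)
    assume "\<not> thesis"
    then have "interior (closure (A k)) = {}" for k using that by blast
    then have "closedin euclidean T \<and> euclidean interior_of T = {}" if "T \<in> range (\<lambda>k. closure (A k))" for T
      using that by auto
    then have "euclidean interior_of \<Union>(range (\<lambda>k. closure (A k))) = {}"
      by (rule Baire_category_alt[OF disjI1[OF completely_metrizable_space_euclidean]
            countable_image[OF countableI_type]])
    then show False unfolding cover by simp
  qed
  then obtain z r where r: "r > 0" "ball z r \<subseteq> closure (A k)"
    by (auto simp: ex_in_conv[symmetric] mem_interior)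
  \<comment> \<open>Write \<open>x\<close> as \<open>(z + x) - z\<close>: both points lie in the
    ball about \<open>z\<close>, hence are limits of points of \<open>A k\<close>. Subtracting their
    approximants moves the ball to the origin at the price of doubling the bound.\<close>
  have close: "\<exists>y. norm (x - y) < \<delta> \<and> (\<forall>N. norm (basis_partial_sum e N y) \<le> 2 * real k)"
    if "norm x < r" "\<delta> > 0" for x \<delta>
  proof -
    have "z + x \<in> closure (A k)" "z \<in> closure (A k)"
      using r that by (auto intro!: subsetD[OF r(2)] simp: dist_norm)
    from this[THEN closure_approachable[THEN iffD1], rule_format, of "\<delta> / 2"]
    obtain y1 y2 where y: "y1 \<in> A k" "dist y1 (z + x) < \<delta> / 2" "y2 \<in> A k" "dist y2 z < \<delta> / 2"
      using \<open>\<delta> > 0\<close> by auto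
    have "norm (x - (y1 - y2)) = norm ((y2 - z) - (y1 - (z + x)))" by (simp add: algebra_simps)
    also have "\<dots> \<le> dist y2 z + dist y1 (z + x)" unfolding dist_norm by (rule norm_triangle_ineq4)
    finally have "norm (x - (y1 - y2)) < \<delta>" using y by simp
    moreover have "norm (basis_partial_sum e N (y1 - y2)) \<le> 2 * real k" for N
    proof -
      have "norm (basis_partial_sum e N (y1 - y2)) \<le> norm (basis_partial_sum e N y1) + norm (basis_partial_sum e N y2)"
        by (simp add: linear_diff[OF lin] norm_triangle_ineq4)
      also have "\<dots> \<le> real k + real k" using y by (intro add_mono) (auto simp: A_def)
      finally show ?thesis by simp
    qed
    ultimately show ?thesis by (intro exI[of _ "y1 - y2"] conjI allI)
  qed
  \<comment> \<open>Undoing the scaling by \<open>t = r / (2 * norm x)\<close> below turns the bound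
    \<open>2 * k\<close> into \<open>4 * k * norm x / r\<close>; the extra 1 keeps \<open>M\<close>
    positive when \<open>k = 0\<close>.\<close>
  define M where "M = (4 * real k + 1) / r"
  have "M > 0" using r by (simp add: M_def)
  moreover have "\<exists>y. norm (x - y) \<le> norm x / 2 \<and> (\<forall>N. norm (basis_partial_sum e N y) \<le> M * norm x)" for x
  proof (cases "x = 0")
    case True
    then show ?thesis by (intro exI[of _ 0]) (simp add: linear_0[OF lin])
  next
    case False
    \<comment> \<open>The scaled vector has norm \<open>r / 2\<close>, inside the ball. The
      tolerance \<open>r / 4\<close> is half of that norm, so rescaling leaves an error of at most
      \<open>norm x / 2\<close>.\<close>
    define t where "t = r / (2 * norm x)"
    have t: "t > 0" using False r by (simp add: t_def)
    have tx: "t * norm x = r / 2" using False by (simp add: t_def)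
    obtain y where y: "norm (t *\<^sub>R x - y) < r / 4" "\<And>N. norm (basis_partial_sum e N y) \<le> 2 * real k"
      using close[of "t *\<^sub>R x" "r / 4"] t tx r by auto
    have "t * norm (x - y /\<^sub>R t) = norm (t *\<^sub>R x - y)"
    proof -
      have "t *\<^sub>R x - y = t *\<^sub>R (x - y /\<^sub>R t)" using t by (simp add: algebra_simps)
      then show ?thesis using t by simp
    qed
    then have "t * norm (x - y /\<^sub>R t) \<le> t * (norm x / 2)" using y(1) tx by simp
    then have "norm (x - y /\<^sub>R t) \<le> norm x / 2" using t by simp
    moreover have "norm (basis_partial_sum e N (y /\<^sub>R t)) \<le> M * norm x" for N
    proof -
      have "norm (basis_partial_sum e N (y /\<^sub>R t)) = norm (basis_partial_sum e N y) / t"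
        using t by (simp add: linear_cmul[OF lin] divide_inverse mult.commute)
      also have "\<dots> \<le> 2 * real k / t" using t y(2) by (intro divide_right_mono) auto
      also have "\<dots> \<le> M * norm x" using r by (simp add: t_def M_def field_simps)
      finally show ?thesis .
    qed
    ultimately show ?thesis by (intro exI[of _ "y /\<^sub>R t"] conjI allI)
  qed
  ultimately show ?thesis by (rule that)
qed

text \<open>Iterating the approximation expands every \<open>x\<close> into a series whose partial sum norms decay
  geometrically; by uniform convergence the coordinates may be summed term by term.\<close>

lemma bounded_linear_basis_coord:
  fixes e :: "nat \<Rightarrow> 'a::banach"
  assumes e: "schauder_basis e"
  shows "bounded_linear (\<lambda>x. basis_coord e x n)"
proof -
  obtain M where "M > 0" and
    "\<forall>x. \<exists>y. norm (x - y) \<le> norm x / 2 \<and> (\<forall>N. norm (basis_partial_sum e N y) \<le> M * norm x)"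
    using basis_partial_sum_approx[OF e] by blast
  from choice[OF this(2)] obtain Y where
    "\<forall>x. norm (x - Y x) \<le> norm x / 2 \<and> (\<forall>N. norm (basis_partial_sum e N (Y x)) \<le> M * norm x)" ..
  then have Y: "norm (x - Y x) \<le> norm x / 2" "norm (basis_partial_sum e N (Y x)) \<le> M * norm x" for x N
    by blast+
  have "\<bar>basis_coord e x n\<bar> \<le> norm x * (4 * M / norm (e n))" for x
  proof -
    \<comment> \<open>\<open>R j\<close> is the remainder after \<open>j\<close> approximations.
      Each approximation halves it, so the pieces \<open>y j\<close> removed along the way sum to
      \<open>x\<close>.\<close>
    define R where "R = rec_nat x (\<lambda>_ z. z - Y z)"
    have R0: "R 0 = x" and RS: "R (Suc j) = R j - Y (R j)" for j by (simp_all add: R_def)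
    have R: "norm (R j) \<le> norm x * (1/2) ^ j" for j
    proof (induction j)
      case (Suc j)
      then show ?case using Y(1)[of "R j"] by (simp add: RS)
    qed (simp add: R0)
    define y where "y j = Y (R j)" for j
    have "(\<lambda>j. norm x * (1/2) ^ j) \<longlonglongrightarrow> 0"
      by (intro tendsto_mult_right_zero LIMSEQ_power_zero) simp
    then have "R \<longlonglongrightarrow> 0" by (rule Lim_null_comparison[OF always_eventually[OF allI[OF R]]])
    moreover have sum_y: "(\<Sum>j<J. y j) = x - R J" for J
      by (induction J) (simp_all add: R0 RS y_def)
    ultimately have lim_y: "(\<lambda>J. \<Sum>j<J. y j) \<longlonglongrightarrow> x"
      using tendsto_diff[of "\<lambda>_. x" x _ R 0] by simp
    define B where "B j = M * norm x * (1/2) ^ j" for j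
    have "(\<lambda>j. (1/2::real) ^ j) sums 2" using geometric_sums[of "1/2::real"] by simp
    from sums_mult[OF this, of "M * norm x"] have sums_B: "B sums (M * norm x * 2)"
      unfolding B_def .
    have S: "norm (basis_partial_sum e N (y j)) \<le> B j" for N j
    proof -
      have "norm (basis_partial_sum e N (y j)) \<le> M * norm (R j)" using Y(2) by (simp add: y_def)
      also have "\<dots> \<le> B j" unfolding B_def using R[of j] \<open>M > 0\<close> by (simp add: mult.assoc)
      finally show ?thesis .
    qed
    \<comment> \<open>A single term is the difference of two consecutive partial sums, whence the
      factor 2.\<close>
    have C: "norm (basis_coord e (y j) m *\<^sub>R e m) \<le> 2 * B j" for m j
    proof -
      have "basis_coord e (y j) m *\<^sub>R e m = basis_partial_sum e (Suc m) (y j) - basis_partial_sum e m (y j)"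
        by (simp add: basis_partial_sum_def)
      then show ?thesis
        using norm_triangle_ineq4[of "basis_partial_sum e (Suc m) (y j)" "basis_partial_sum e m (y j)"]
          S[of "Suc m" j] S[of m j] by simp
    qed
    have summable_coord: "summable (\<lambda>j. basis_coord e (y j) m)" for m
    proof (rule summable_comparison_test)
      have "norm (e m) > 0" using schauder_basis_nonzero[OF e] by simp
      then show "\<exists>N. \<forall>j\<ge>N. norm (basis_coord e (y j) m) \<le> 2 * B j / norm (e m)"
        using C[of _ m] by (simp add: pos_le_divide_eq)
      show "summable (\<lambda>j. 2 * B j / norm (e m))"
        using sums_B by (intro summable_divide summable_mult) (rule sums_summable)
    qed
    define c where "c m = (\<Sum>j. basis_coord e (y j) m)" for m
    have c: "(\<lambda>j. basis_coord e (y j) m *\<^sub>R e m) sums (c m *\<^sub>R e m)" for m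
      unfolding c_def using summable_coord by (intro sums_scaleR_left summable_sums)
    \<comment> \<open>Two iterated limits of the same double sequence are compared. Letting
      \<open>N\<close> grow first gives the sums of the \<open>y j\<close>, which tend to
      \<open>x\<close>; letting \<open>J\<close> grow first gives the partial sums of the series
      with coefficients \<open>c\<close>. The bounds \<open>B j\<close> make the second limit
      uniform in \<open>N\<close>.\<close>
    have "(\<lambda>N. \<Sum>j. basis_partial_sum e N (y j)) \<longlonglongrightarrow> x"
    proof (rule swap_uniform_limit'[OF _ lim_y])
      show "\<forall>\<^sub>F J in sequentially. (\<lambda>N. \<Sum>j<J. basis_partial_sum e N (y j)) \<longlonglongrightarrow> (\<Sum>j<J. y j)"
        by (intro always_eventually allI tendsto_sum basis_partial_sum_tendsto[OF e])
      show "uniform_limit UNIV (\<lambda>J N. \<Sum>j<J. basis_partial_sum e N (y j))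
              (\<lambda>N. \<Sum>j. basis_partial_sum e N (y j)) sequentially"
        by (rule Weierstrass_m_test[OF S sums_summable[OF sums_B]])
    qed auto
    moreover have "(\<Sum>j. basis_partial_sum e N (y j)) = (\<Sum>m<N. c m *\<^sub>R e m)" for N
      unfolding basis_partial_sum_def by (intro sums_unique[symmetric] sums_sum c)
    ultimately have "(\<lambda>m. c m *\<^sub>R e m) sums x" by (simp add: sums_def)
    then have "basis_coord e x n = c n" by (simp add: basis_coord_eqI[OF e])
    moreover have "norm (c n *\<^sub>R e n) \<le> 4 * M * norm x"
    proof -
      have "(\<lambda>j. 2 * B j) sums (4 * M * norm x)" using sums_mult[OF sums_B, of 2] by (simp add: mult.assoc mult.left_commute mult.commute)
      from norm_sums_le[OF c[of n] this C] show ?thesis .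
    qed
    moreover have "norm (e n) > 0" using schauder_basis_nonzero[OF e] by simp
    ultimately show ?thesis by (simp add: pos_le_divide_eq mult.commute)
  qed
  then show ?thesis
    by (intro bounded_linear_intro[where K="4 * M / norm (e n)"])
       (simp_all add: linear_add[OF linear_basis_coord[OF e]] linear_cmul[OF linear_basis_coord[OF e]])
qed

subsection \<open>Nonsupport points of the positive cone\<close>

lemma mem_positive_cone_iff:
  assumes e: "schauder_basis e"
  shows "x \<in> positive_cone e \<longleftrightarrow> (\<forall>n. 0 \<le> basis_coord e x n)"
  using basis_coord_sums[OF e, of x] basis_coord_eqI[OF e]
  unfolding positive_cone_def by blast

lemma nonsupport_points_positive_cone:
  fixes e :: "nat \<Rightarrow> 'a::banach"
  assumes e: "schauder_basis e"
  shows "nonsupport_points (positive_cone e) = {x. \<forall>n. 0 < basis_coord e x n}"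
proof (intro equalityI subsetI CollectI allI)
  note cone = mem_positive_cone_iff[OF e]
  fix x n
  assume "x \<in> nonsupport_points (positive_cone e)"
  then have x: "x \<in> positive_cone e" "\<not> support_point (positive_cone e) x"
    by (auto simp: nonsupport_points_def)
  show "0 < basis_coord e x n"
  proof (rule ccontr)
    assume "\<not> 0 < basis_coord e x n"
    then have x0: "basis_coord e x n = 0" using x(1) by (simp add: cone order_antisym)
    define f where "f = Blinfun (\<lambda>y. - basis_coord e y n)"
    have f: "blinfun_apply f y = - basis_coord e y n" for y
      unfolding f_def
      by (simp add: bounded_linear_Blinfun_apply bounded_linear_minus bounded_linear_basis_coord[OF e])
    have "blinfun_apply f (e n) \<noteq> 0" by (simp add: f basis_coord_basis[OF e])
    then have "f \<noteq> 0" by auto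
    moreover have "\<forall>y\<in>positive_cone e. blinfun_apply f y \<le> blinfun_apply f x"
      by (simp add: f x0 cone)
    ultimately show False using x unfolding support_point_def by blast
  qed
next
  note cone = mem_positive_cone_iff[OF e]
  fix x
  assume "x \<in> {x. \<forall>n. 0 < basis_coord e x n}"
  then have pos: "0 < basis_coord e x n" for n by simp
  then have x: "x \<in> positive_cone e" by (simp add: cone less_imp_le)
  have "f = 0" if f: "\<forall>y\<in>positive_cone e. blinfun_apply f y \<le> blinfun_apply f x" for f :: "'a \<Rightarrow>\<^sub>L real"
  proof -
    \<comment> \<open>Comparing with the cone points \<open>2 *\<^sub>R x\<close> and 0 bounds
      \<open>f x\<close> from above and from below by 0.\<close>
    have "2 *\<^sub>R x \<in> positive_cone e" "0 \<in> positive_cone e"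
      using pos by (simp_all add: cone linear_cmul[OF linear_basis_coord[OF e]]
          linear_0[OF linear_basis_coord[OF e]] less_imp_le)
    with f have "blinfun_apply f (2 *\<^sub>R x) \<le> blinfun_apply f x" "blinfun_apply f 0 \<le> blinfun_apply f x"
      by blast+
    then have fx: "blinfun_apply f x = 0" by (simp add: blinfun.scaleR_right)
    have fe: "blinfun_apply f (e n) \<le> 0" for n
    proof -
      have "e n \<in> positive_cone e" by (simp add: cone basis_coord_basis[OF e])
      then show ?thesis using f fx by fastforce
    qed
    have sums: "(\<lambda>n. basis_coord e y n * blinfun_apply f (e n)) sums blinfun_apply f y" for y
      using bounded_linear.sums[OF blinfun.bounded_linear_right basis_coord_sums[OF e, of y], of f]
      by (simp add: blinfun.scaleR_right)
    \<comment> \<open>Since \<open>f x = 0\<close>, this is a series of nonnegative terms with sum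
      0, so each term vanishes.\<close>
    have "(\<lambda>n. - (basis_coord e x n * blinfun_apply f (e n))) sums 0"
      using sums_minus[OF sums[of x]] fx by simp
    moreover have nonneg: "0 \<le> - (basis_coord e x n * blinfun_apply f (e n))" for n
      using fe[of n] pos[of n] by (simp add: mult_le_0_iff)
    ultimately have "- (basis_coord e x n * blinfun_apply f (e n)) = 0" for n
      using suminf_eq_zero_iff[of "\<lambda>n. - (basis_coord e x n * blinfun_apply f (e n))"]
      by (simp add: sums_iff)
    from this pos have "blinfun_apply f (e n) = 0" for n
      by (simp add: less_imp_neq[THEN not_sym])
    then have "blinfun_apply f y = 0" for y
      using sums[of y] by (simp add: sums_iff)
    then show ?thesis by (intro blinfun_eqI) simp
  qed
  then show "x \<in> nonsupport_points (positive_cone e)"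
    using x unfolding nonsupport_points_def support_point_def by blast
qed

subsection \<open>Unconditional convergence and bounded multipliers\<close>

text \<open>The norm is convex in the weights \<open>a\<close>, so on the unit cube it is bounded by
  its values at the vertices, which are the subset sums. The induction interpolates in one weight at
  a time; the offset \<open>c\<close> absorbs \<open>f m\<close> at the vertex where that weight is
  1.\<close>

lemma norm_sum_scaled_le_of_subset_sums:
  fixes f :: "'b \<Rightarrow> 'a::real_normed_vector" and a :: "'b \<Rightarrow> real"
  assumes "finite F"
    and "\<And>n. n \<in> F \<Longrightarrow> 0 \<le> a n" "\<And>n. n \<in> F \<Longrightarrow> a n \<le> 1"
    and "\<And>S. S \<subseteq> F \<Longrightarrow> norm (c + sum f S) \<le> M"
  shows "norm (c + (\<Sum>n\<in>F. a n *\<^sub>R f n)) \<le> M"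
  using assms
proof (induction F arbitrary: c rule: finite_induct)
  case empty
  show ?case using empty.prems(3)[of "{}"] by simp
next
  case (insert m F)
  let ?s = "\<Sum>n\<in>F. a n *\<^sub>R f n"
  have 1: "norm (c + ?s) \<le> M"
  proof (rule insert.IH)
    fix S assume "S \<subseteq> F"
    then show "norm (c + sum f S) \<le> M" by (intro insert.prems(3)) blast
  qed (use insert.prems(1,2) in simp_all)
  have 2: "norm ((c + f m) + ?s) \<le> M"
  proof (rule insert.IH)
    fix S assume "S \<subseteq> F"
    then have "finite S" "m \<notin> S" "Set.insert m S \<subseteq> Set.insert m F"
      using insert.hyps finite_subset by auto
    then show "norm (c + f m + sum f S) \<le> M"
      using insert.prems(3)[of "Set.insert m S"] by (simp add: add.assoc)
  qed (use insert.prems(1,2) in simp_all)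
  have m: "0 \<le> a m" "a m \<le> 1" using insert.prems by auto
  have "c + (\<Sum>n\<in>Set.insert m F. a n *\<^sub>R f n)
      = (1 - a m) *\<^sub>R (c + ?s) + a m *\<^sub>R ((c + f m) + ?s)"
    using insert.hyps by (simp add: algebra_simps)
  also have "norm \<dots> \<le> (1 - a m) * norm (c + ?s) + a m * norm ((c + f m) + ?s)"
    using m norm_triangle_ineq[of "(1 - a m) *\<^sub>R (c + ?s)" "a m *\<^sub>R ((c + f m) + ?s)"] by simp
  also have "\<dots> \<le> (1 - a m) * M + a m * M"
    using m 1 2 by (intro add_mono mult_left_mono) auto
  finally show ?case by (simp add: algebra_simps)
qed

text \<open>A bijection of an initial segment of the block onto \<open>F\<close> extends to the
  block because the complements have equal size. It serves to bring \<open>F\<close> to the front,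
  where its sum is a sum over consecutive indices.\<close>

lemma ex_block_bijection:
  fixes F :: "nat set"
  assumes "F \<subseteq> {N..<M}"
  shows "\<exists>p. bij_betw p {N..<M} {N..<M} \<and> p ` {N..<N + card F} = F \<and> inj_on p {N..<N + card F}"
proof -
  have fin: "finite F" using assms finite_subset by blast
  have "card F \<le> M - N"
    using card_mono[OF _ assms] by simp
  then have sub: "{N..<N + card F} \<subseteq> {N..<M}" by auto
  obtain g where g: "bij_betw g {N..<N + card F} F"
    using finite_same_card_bij[of "{N..<N + card F}" F] fin by auto
  have "card ({N..<M} - {N..<N + card F}) = card ({N..<M} - F)"
    using card_Diff_subset[OF _ sub] card_Diff_subset[OF fin assms] by simp
  then obtain h where h: "bij_betw h ({N..<M} - {N..<N + card F}) ({N..<M} - F)"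
    using finite_same_card_bij[of "{N..<M} - {N..<N + card F}" "{N..<M} - F"] by blast
  let ?p = "\<lambda>x. if x \<in> {N..<N + card F} then g x else h x"
  have "bij_betw ?p ({N..<N + card F} \<union> ({N..<M} - {N..<N + card F})) (F \<union> ({N..<M} - F))"
    by (rule bij_betw_disjoint_Un[OF g h]) auto
  moreover have "{N..<N + card F} \<union> ({N..<M} - {N..<N + card F}) = {N..<M}" "F \<union> ({N..<M} - F) = {N..<M}"
    using sub assms by auto
  ultimately have "bij_betw ?p {N..<M} {N..<M}" by simp
  moreover have "bij_betw ?p {N..<N + card F} F"
    using g bij_betw_cong[of "{N..<N + card F}" ?p g] by simp
  then have "?p ` {N..<N + card F} = F" "inj_on ?p {N..<N + card F}"
    by (simp_all only: bij_betw_def)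
  ultimately show ?thesis by (intro exI[of _ ?p] conjI)
qed

text \<open>If the claim fails, there are consecutive blocks of indices, each containing a finite set with a large sum;
  a permutation that moves these sets to the front of their blocks destroys the Cauchy criterion.\<close>

lemma unconditionally_convergent_small_tail_sums:
  fixes f :: "nat \<Rightarrow> 'a::banach"
  assumes f: "unconditionally_convergent f" and "\<epsilon> > 0"
  obtains N where "\<And>F. finite F \<Longrightarrow> F \<subseteq> {N..} \<Longrightarrow> norm (sum f F) < \<epsilon>"
proof -
  have "\<exists>N. \<forall>F. finite F \<longrightarrow> F \<subseteq> {N..} \<longrightarrow> norm (sum f F) < \<epsilon>"
  proof (rule ccontr)
    assume neg: "\<not> ?thesis"
    have "\<exists>F M. F \<subseteq> {N..<M} \<and> N < M \<and> \<epsilon> \<le> norm (sum f F)" for N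
    proof -
      obtain F where F: "finite F" "F \<subseteq> {N..}" "\<epsilon> \<le> norm (sum f F)"
        using neg by (meson not_le)
      obtain m where "F \<subseteq> {..<m}" using F(1) finite_nat_iff_bounded by blast
      \<comment> \<open>Taking the maximum with \<open>Suc N\<close> ensures \<open>N < M\<close>,
        so that the block endpoints chosen later increase strictly.\<close>
      with F have "F \<subseteq> {N..<max m (Suc N)}"
        by (auto simp: subset_eq less_max_iff_disj)
      then show ?thesis using F(3) by (intro exI[of _ F] exI[of _ "max m (Suc N)"]) auto
    qed
    then obtain F M where FM: "\<And>N. F N \<subseteq> {N..<M N}" "\<And>N. N < M N" "\<And>N. \<epsilon> \<le> norm (sum f (F N))"
      by metis
    have "\<forall>N. \<exists>p. bij_betw p {N..<M N} {N..<M N} \<and> p ` {N..<N + card (F N)} = F N \<and> inj_on p {N..<N + card (F N)}"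
      by (intro allI ex_block_bijection FM(1))
    from choice[OF this] obtain p where p: "\<And>N. bij_betw (p N) {N..<M N} {N..<M N}"
      "\<And>N. p N ` {N..<N + card (F N)} = F N" "\<And>N. inj_on (p N) {N..<N + card (F N)}"
      by auto
    \<comment> \<open>Each block \<open>{b k..<b (Suc k)}\<close> starts where the previous one
      ends. Since \<open>b 0 = 0\<close>, the blocks partition the natural numbers, and
      \<open>K n\<close> below is the number of the block containing \<open>n\<close>.\<close>
    define b where "b = rec_nat 0 (\<lambda>_. M)"
    have b0: "b 0 = 0" and bS: "b (Suc k) = M (b k)" for k by (simp_all add: b_def)
    have sm: "strict_mono b" by (rule strict_monoI_Suc) (simp add: bS FM(2))
    have "\<exists>k. n \<in> {b k..<b (Suc k)}" for n
    proof (induction n)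
      case 0
      show ?case using FM(2)[of 0] by (intro exI[of _ 0]) (simp add: b0 bS)
    next
      case (Suc n)
      then obtain k where k: "b k \<le> n" "n < b (Suc k)" by auto
      show ?case
      proof (cases "Suc n < b (Suc k)")
        case True
        then show ?thesis using k by (intro exI[of _ k]) auto
      next
        case False
        then have "b (Suc k) = Suc n" using k by auto
        then show ?thesis using FM(2)[of "b (Suc k)"] by (intro exI[of _ "Suc k"]) (auto simp: bS)
      qed
    qed
    then obtain K where K: "\<And>n. n \<in> {b (K n)..<b (Suc (K n))}" by metis
    have Kuniq: "K n = k" if "n \<in> {b k..<b (Suc k)}" for n k
    proof (rule ccontr)
      assume "K n \<noteq> k"
      then have "Suc (K n) \<le> k \<or> Suc k \<le> K n" by auto
      then have "b (Suc (K n)) \<le> b k \<or> b (Suc k) \<le> b (K n)"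
        using sm by (simp add: strict_mono_less_eq)
      then show False using that K[of n] by auto
    qed
    \<comment> \<open>The block permutations are glued together. As each preserves its block,
      bijectivity can be checked block by block.\<close>
    define \<pi> where "\<pi> n = p (b (K n)) n" for n
    have pB: "bij_betw (p (b k)) {b k..<b (Suc k)} {b k..<b (Suc k)}" for k
      using p(1)[of "b k"] by (simp add: bS)
    have \<pi>B: "\<pi> n \<in> {b (K n)..<b (Suc (K n))}" for n
      using bij_betwE[OF pB] K unfolding \<pi>_def by blast
    have "inj \<pi>"
    proof (rule injI)
      fix m n assume eq: "\<pi> m = \<pi> n"
      then have "K m = K n" using Kuniq[OF \<pi>B[of m]] Kuniq[OF \<pi>B[of n]] by simp
      then show "m = n"
        using eq K[of m] K[of n] bij_betw_imp_inj_on[OF pB[of "K n"]] unfolding \<pi>_def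
        by (auto dest: inj_onD)
    qed
    moreover have "surj \<pi>"
      unfolding surj_def
    proof
      fix n
      have "n \<in> p (b (K n)) ` {b (K n)..<b (Suc (K n))}"
        using pB[of "K n"] K[of n] by (simp add: bij_betw_def)
      then obtain m where m: "m \<in> {b (K n)..<b (Suc (K n))}" "n = p (b (K n)) m" by blast
      then show "\<exists>m. n = \<pi> m" using Kuniq[OF m(1)] by (metis \<pi>_def)
    qed
    ultimately have "summable (f \<circ> \<pi>)" using f by (simp add: unconditionally_convergent_def bij_def)
    then obtain N where N: "\<And>m n. m \<ge> N \<Longrightarrow> norm (sum (f \<circ> \<pi>) {m..<n}) < \<epsilon>"
      using \<open>\<epsilon> > 0\<close> unfolding summable_Cauchy by meson
    \<comment> \<open>This front segment of block \<open>N\<close> lies beyond the Cauchy threshold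
      because \<open>N \<le> b N\<close>, yet its rearranged sum is that of \<open>F (b N)\<close>,
      of norm at least \<epsilon>.\<close>
    let ?I = "{b N..<b N + card (F (b N))}"
    have "?I \<subseteq> {b N..<b (Suc N)}"
      using card_mono[OF _ FM(1)[of "b N"]] FM(2)[of "b N"] by (auto simp: bS)
    then have \<pi>p: "\<pi> n = p (b N) n" if "n \<in> ?I" for n
      using Kuniq[of n N] that by (auto simp: \<pi>_def)
    have "sum (f \<circ> \<pi>) ?I = (\<Sum>n\<in>?I. f (p (b N) n))"
      using \<pi>p by (intro sum.cong) auto
    also have "\<dots> = sum f (F (b N))"
      using sum.reindex[OF p(3), of f "b N"] by (simp add: p(2))
    finally show False
      using N[of "b N" "b N + card (F (b N))"] FM(3)[of "b N"] strict_mono_imp_increasing[OF sm, of N]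
      by simp
  qed
  then obtain N where "\<forall>F. finite F \<longrightarrow> F \<subseteq> {N..} \<longrightarrow> norm (sum f F) < \<epsilon>" ..
  then show ?thesis by (intro that[of N]) simp
qed

text \<open>For multipliers in [0,1], convexity reduces the Cauchy criterion to subset sums of the
  tail, which are small by unconditional convergence. An affine change of the multiplier gives the
  general case.\<close>

lemma unconditionally_convergent_bounded_multiplier:
  fixes f :: "nat \<Rightarrow> 'a::banach" and y :: "nat \<Rightarrow> real"
  assumes f: "unconditionally_convergent f" and y: "\<And>n. \<bar>y n\<bar> \<le> B"
  shows "summable (\<lambda>n. y n *\<^sub>R f n)"
proof -
  have unit: "summable (\<lambda>n. a n *\<^sub>R f n)" if a: "\<And>n. 0 \<le> a n" "\<And>n. a n \<le> 1" for a :: "nat \<Rightarrow> real"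
    unfolding summable_Cauchy
  proof (intro allI impI)
    fix \<epsilon> :: real assume "\<epsilon> > 0"
    \<comment> \<open>The convexity bound is not strict; halving \<epsilon> recovers the strict
      inequality.\<close>
    then obtain N where N: "\<And>F. finite F \<Longrightarrow> F \<subseteq> {N..} \<Longrightarrow> norm (sum f F) < \<epsilon> / 2"
      using unconditionally_convergent_small_tail_sums[OF f, of "\<epsilon> / 2"] by auto
    have le: "norm (0 + (\<Sum>n\<in>{m..<n}. a n *\<^sub>R f n)) \<le> \<epsilon> / 2" if "m \<ge> N" for m n
    proof (rule norm_sum_scaled_le_of_subset_sums)
      fix S assume "S \<subseteq> {m..<n}"
      then have "finite S" "S \<subseteq> {N..}" using that finite_subset by auto
      then show "norm (0 + sum f S) \<le> \<epsilon> / 2" using N[of S] by simp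
    qed (use a in auto)
    have "norm (\<Sum>n\<in>{m..<n}. a n *\<^sub>R f n) < \<epsilon>" if "m \<ge> N" for m n
      using le[OF that, of n] \<open>\<epsilon> > 0\<close> by simp
    then show "\<exists>N. \<forall>m\<ge>N. \<forall>n. norm (\<Sum>n\<in>{m..<n}. a n *\<^sub>R f n) < \<epsilon>"
      by blast
  qed
  \<comment> \<open>Adding 1 makes \<open>C\<close> positive even for \<open>B = 0\<close>, so
    \<open>(y n + C) / (2 * C)\<close> is defined and lies in [0,1].\<close>
  define C where "C = \<bar>B\<bar> + 1"
  have C: "C > 0" by (simp add: C_def)
  have yC: "- C \<le> y n" "y n \<le> C" for n using y[of n] by (auto simp: C_def)
  have "0 \<le> y n + C" for n using yC(1)[of n] by linarith
  then have "summable (\<lambda>n. ((y n + C) / (2 * C)) *\<^sub>R f n)"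
    using yC C by (intro unit) simp_all
  moreover have "summable f"
    using unit[of "\<lambda>_. 1"] by simp
  ultimately have "summable (\<lambda>n. (2 * C) *\<^sub>R (((y n + C) / (2 * C)) *\<^sub>R f n) - C *\<^sub>R f n)"
    by (intro summable_diff summable_scaleR_right)
  moreover have "(2 * C) *\<^sub>R (((y n + C) / (2 * C)) *\<^sub>R f n) - C *\<^sub>R f n = y n *\<^sub>R f n" for n
    using C by (simp add: scaleR_add_left)
  ultimately show ?thesis by simp
qed

subsection \<open>The order unit space\<close>

lemma mem_order_interval_positive_cone_iff:
  assumes e: "schauder_basis e"
  shows "x \<in> order_interval (positive_cone e) u \<longleftrightarrow> (\<forall>n. \<bar>basis_coord e x n\<bar> \<le> basis_coord e u n)"
proof -
  have "x \<in> order_interval (positive_cone e) u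
    \<longleftrightarrow> (\<forall>n. 0 \<le> basis_coord e x n + basis_coord e u n \<and> 0 \<le> basis_coord e u n - basis_coord e x n)"
    by (simp add: order_interval_def cone_le_def mem_positive_cone_iff[OF e] all_conj_distrib
        linear_diff[OF linear_basis_coord[OF e]] linear_add[OF linear_basis_coord[OF e]])
  also have "\<dots> \<longleftrightarrow> (\<forall>n. \<bar>basis_coord e x n\<bar> \<le> basis_coord e u n)"
    by (intro all_cong1) linarith
  finally show ?thesis .
qed

lemma mem_scaled_order_interval_iff:
  assumes e: "schauder_basis e" and t: "t > 0"
  shows "x \<in> (*\<^sub>R) t ` order_interval (positive_cone e) u
    \<longleftrightarrow> (\<forall>n. \<bar>basis_coord e x n\<bar> \<le> t * basis_coord e u n)"
proof -
  have "x \<in> (*\<^sub>R) t ` order_interval (positive_cone e) u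
    \<longleftrightarrow> x /\<^sub>R t \<in> order_interval (positive_cone e) u"
  proof
    assume "x /\<^sub>R t \<in> order_interval (positive_cone e) u"
    moreover have "x = t *\<^sub>R (x /\<^sub>R t)" using t by simp
    ultimately show "x \<in> (*\<^sub>R) t ` order_interval (positive_cone e) u" by blast
  qed (use t in auto)
  also have "\<dots> \<longleftrightarrow> (\<forall>n. \<bar>basis_coord e x n\<bar> \<le> t * basis_coord e u n)"
    using t by (simp add: mem_order_interval_positive_cone_iff[OF e]
        linear_cmul[OF linear_basis_coord[OF e]] abs_mult field_simps)
  finally show ?thesis .
qed

lemma mem_cone_at_positive_cone_iff:
  assumes e: "schauder_basis e"
  shows "x \<in> cone_at (positive_cone e) u
    \<longleftrightarrow> (\<exists>t>0. \<forall>n. - basis_coord e x n \<le> t * basis_coord e u n)"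
proof -
  have "(\<exists>y\<in>positive_cone e. x = t *\<^sub>R (y - u)) \<longleftrightarrow> (\<forall>n. - basis_coord e x n \<le> t * basis_coord e u n)"
    if t: "t > 0" for t
  proof -
    have "x = t *\<^sub>R (y - u) \<longleftrightarrow> y = x /\<^sub>R t + u" for y
    proof
      assume "x = t *\<^sub>R (y - u)"
      then show "y = x /\<^sub>R t + u" using t by simp
    next
      assume "y = x /\<^sub>R t + u"
      then show "x = t *\<^sub>R (y - u)" using t by simp
    qed
    then have "(\<exists>y\<in>positive_cone e. x = t *\<^sub>R (y - u)) \<longleftrightarrow> x /\<^sub>R t + u \<in> positive_cone e" by simp
    also have "\<dots> \<longleftrightarrow> (\<forall>n. 0 \<le> basis_coord e x n / t + basis_coord e u n)"
      by (simp add: mem_positive_cone_iff[OF e] linear_cmul[OF linear_basis_coord[OF e]]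
          linear_add[OF linear_basis_coord[OF e]] divide_inverse mult.commute)
    also have "\<dots> \<longleftrightarrow> (\<forall>n. - basis_coord e x n \<le> t * basis_coord e u n)"
    proof (intro all_cong1)
      fix n
      have "basis_coord e x n / t + basis_coord e u n = (basis_coord e x n + t * basis_coord e u n) / t"
        using t by (simp add: field_simps)
      then show "0 \<le> basis_coord e x n / t + basis_coord e u n \<longleftrightarrow> - basis_coord e x n \<le> t * basis_coord e u n"
        using t by (simp add: zero_le_divide_iff) linarith
    qed
    finally show ?thesis .
  qed
  moreover have "x \<in> cone_at (positive_cone e) u \<longleftrightarrow> (\<exists>t>0. \<exists>y\<in>positive_cone e. x = t *\<^sub>R (y - u))"
    unfolding cone_at_def UN_iff image_iff Bex_def greaterThan_iff ..
  ultimately show ?thesis by (simp cong: conj_cong)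
qed

text \<open>The two cones bound the coordinates from below and from above, possibly with different
  scales. Since the coordinates of \<open>u\<close> are positive, the larger scale serves for
  both.\<close>

lemma mem_unit_space_positive_cone_iff:
  assumes e: "schauder_basis e" and u: "\<And>n. 0 < basis_coord e u n"
  shows "x \<in> unit_space (positive_cone e) u
    \<longleftrightarrow> (\<exists>t>0. \<forall>n. \<bar>basis_coord e x n\<bar> \<le> t * basis_coord e u n)"
proof -
  have "x \<in> uminus ` cone_at (positive_cone e) u \<longleftrightarrow> - x \<in> cone_at (positive_cone e) u"
    by (metis image_iff minus_minus)
  then have "x \<in> unit_space (positive_cone e) u
    \<longleftrightarrow> (\<exists>t>0. \<forall>n. - basis_coord e x n \<le> t * basis_coord e u n)
      \<and> (\<exists>t>0. \<forall>n. basis_coord e x n \<le> t * basis_coord e u n)"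
    by (simp add: unit_space_def mem_cone_at_positive_cone_iff[OF e]
        linear_neg[OF linear_basis_coord[OF e]])
  also have "\<dots> \<longleftrightarrow> (\<exists>t>0. \<forall>n. \<bar>basis_coord e x n\<bar> \<le> t * basis_coord e u n)" (is "?L \<longleftrightarrow> ?R")
  proof
    assume ?L
    then obtain s t where st: "s > 0" "\<And>n. - basis_coord e x n \<le> s * basis_coord e u n"
      "t > 0" "\<And>n. basis_coord e x n \<le> t * basis_coord e u n" by blast
    have "\<bar>basis_coord e x n\<bar> \<le> max s t * basis_coord e u n" for n
    proof -
      have "s * basis_coord e u n \<le> max s t * basis_coord e u n"
        "t * basis_coord e u n \<le> max s t * basis_coord e u n"
        using u[of n] by (simp_all add: mult_right_mono)
      then show ?thesis using st(2)[of n] st(4)[of n] by (simp add: abs_le_iff)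
    qed
    then show ?R using st(1) by (intro exI[of _ "max s t"]) auto
  next
    assume ?R
    then show ?L by (auto simp: abs_le_iff)
  qed
  finally show ?thesis .
qed

section \<open>The isometry with the bounded sequences\<close>

lemma unit_space_isometric_linfty:
  fixes e :: "nat \<Rightarrow> 'a::banach"
  assumes e: "unconditional_basis e" and u: "\<And>n. 0 < basis_coord e u n"
  shows "\<exists>T :: linfty \<Rightarrow> 'a. linear T \<and> bij_betw T UNIV (unit_space (positive_cone e) u) \<and>
           (\<forall>y. unit_norm (positive_cone e) u (T y) = norm y)"
proof -
  have s: "schauder_basis e" using e by (simp add: unconditional_basis_def)
  have unc: "unconditionally_convergent (\<lambda>n. basis_coord e u n *\<^sub>R e n)"
    using e sums_summable[OF basis_coord_sums[OF s, of u]] by (simp add: unconditional_basis_def)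
  define T :: "linfty \<Rightarrow> 'a" where "T y = (\<Sum>n. (apply_bcontfun y n * basis_coord e u n) *\<^sub>R e n)" for y
  have "summable (\<lambda>n. (apply_bcontfun y n * basis_coord e u n) *\<^sub>R e n)" for y :: linfty
    using unconditionally_convergent_bounded_multiplier[OF unc, of "apply_bcontfun y" "norm y"]
      norm_bounded[of y] by simp
  then have T: "basis_coord e (T y) n = apply_bcontfun y n * basis_coord e u n" for y n
    unfolding T_def by (simp add: basis_coord_eqI[OF s summable_sums])
  have eqI: "x = y" if "\<And>n. basis_coord e x n = basis_coord e y n" for x y
    using sums_unique2[of "\<lambda>n. basis_coord e x n *\<^sub>R e n" x y]
      basis_coord_sums[OF s, of x] basis_coord_sums[OF s, of y] that by simp
  \<comment> \<open>Cancelling the positive coordinates of \<open>u\<close> turns the order bound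
    into a supremum bound. This one equivalence yields both the range of \<open>T\<close> and the
    norm identity.\<close>
  have bound: "(\<forall>n. \<bar>basis_coord e (T y) n\<bar> \<le> t * basis_coord e u n) \<longleftrightarrow> norm y \<le> t" for y t
  proof -
    have "\<bar>basis_coord e (T y) n\<bar> \<le> t * basis_coord e u n \<longleftrightarrow> norm (apply_bcontfun y n) \<le> t" for n
      using u[of n] by (simp add: T abs_mult)
    then show ?thesis
      using norm_bound[of y t] order_trans[OF norm_bounded[of y], of t] by (simp only:) blast
  qed
  have "linear T"
    by (rule linearI; rule eqI)
      (simp_all add: T linear_add[OF linear_basis_coord[OF s]]
        linear_cmul[OF linear_basis_coord[OF s]] distrib_right)
  moreover have "bij_betw T UNIV (unit_space (positive_cone e) u)"
    unfolding bij_betw_def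
  proof (intro conjI equalityI subsetI)
    show "inj T"
    proof (rule injI, rule bcontfun_eqI)
      fix y z n assume "T y = T z"
      then show "apply_bcontfun y n = apply_bcontfun z n"
        using T[of y n] T[of z n] u[of n] by simp
    qed
  next
    fix x assume "x \<in> range T"
    then obtain y where "x = T y" by blast
    \<comment> \<open>The scale must be strictly positive, while \<open>norm y\<close> may be 0;
      hence the added 1.\<close>
    moreover have "norm y \<le> norm y + 1" "0 < norm y + 1" by (simp_all add: add_nonneg_pos)
    ultimately show "x \<in> unit_space (positive_cone e) u"
      unfolding mem_unit_space_positive_cone_iff[OF s u] using bound[of y "norm y + 1"] by blast
  next
    fix x assume "x \<in> unit_space (positive_cone e) u"
    then obtain t where t: "\<And>n. \<bar>basis_coord e x n\<bar> \<le> t * basis_coord e u n"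
      unfolding mem_unit_space_positive_cone_iff[OF s u] by blast
    \<comment> \<open>The preimage of \<open>x\<close> is its coordinate sequence divided by that of
      \<open>u\<close>, bounded by \<open>t\<close>.\<close>
    have "(\<lambda>n. basis_coord e x n / basis_coord e u n) \<in> bcontfun"
      using t u by (intro bcontfun_normI[where b = t]) (auto simp: pos_divide_le_eq abs_of_pos)
    then obtain y where y: "(\<lambda>n. basis_coord e x n / basis_coord e u n) = apply_bcontfun y"
      by (rule bcontfunE)
    have "x = T y"
    proof (rule eqI)
      fix n show "basis_coord e x n = basis_coord e (T y) n"
        using u[of n] by (simp add: T y[symmetric])
    qed
    then show "x \<in> range T" by blast
  qed
  moreover have "unit_norm (positive_cone e) u (T y) = norm y" for y
  proof -
    have "{t. t > 0 \<and> T y \<in> (*\<^sub>R) t ` order_interval (positive_cone e) u} = {t. t > 0 \<and> norm y \<le> t}"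
      by (simp add: mem_scaled_order_interval_iff[OF s] bound cong: conj_cong)
    also have "Inf \<dots> = norm y"
    \<comment> \<open>For \<open>y = 0\<close> the condition \<open>t > 0\<close> excludes the
      infimum 0 from the set; otherwise the infimum \<open>norm y\<close> is attained.\<close>
    proof (cases "y = 0")
      case True
      then have "{t. t > 0 \<and> norm y \<le> t} = {0<..}" by auto
      then show ?thesis using True by simp
    next
      case False
      then have "{t. t > 0 \<and> norm y \<le> t} = {norm y..}" by (auto intro: less_le_trans[of _ "norm y"])
      then show ?thesis by simp
    qed
    finally show ?thesis by (simp add: unit_norm_def)
  qed
  ultimately show ?thesis by blast
qed

theorem theorem7:
  fixes e :: "nat \<Rightarrow> 'a::banach"
  assumes "unconditional_basis e"
  shows "nonsupport_points (positive_cone e)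
           = {x. \<exists>a :: nat \<Rightarrow> real. (\<forall>n. a n > 0) \<and> (\<lambda>n. a n *\<^sub>R e n) sums x} \<and>
         (\<forall>u \<in> nonsupport_points (positive_cone e).
           \<exists>T :: linfty \<Rightarrow> 'a.
             linear T \<and> bij_betw T UNIV (unit_space (positive_cone e) u) \<and>
             (\<forall>y. unit_norm (positive_cone e) u (T y) = norm y))"
proof
  have s: "schauder_basis e" using assms by (simp add: unconditional_basis_def)
  have "(\<forall>n. 0 < basis_coord e x n) \<longleftrightarrow> (\<exists>a. (\<forall>n. a n > 0) \<and> (\<lambda>n. a n *\<^sub>R e n) sums x)" for x
    using basis_coord_sums[OF s, of x] basis_coord_eqI[OF s] by blast
  then show "nonsupport_points (positive_cone e)
           = {x. \<exists>a :: nat \<Rightarrow> real. (\<forall>n. a n > 0) \<and> (\<lambda>n. a n *\<^sub>R e n) sums x}"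
    by (simp add: nonsupport_points_positive_cone[OF s])
  show "\<forall>u \<in> nonsupport_points (positive_cone e).
           \<exists>T :: linfty \<Rightarrow> 'a.
             linear T \<and> bij_betw T UNIV (unit_space (positive_cone e) u) \<and>
             (\<forall>y. unit_norm (positive_cone e) u (T y) = norm y)"
    using unit_space_isometric_linfty[OF assms] by (simp add: nonsupport_points_positive_cone[OF s])
qed

end
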